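(* Let $A\in\mathbb{R}^{n\times n}$ be a group monotone matrix and let $A=K-L=U-V=X-Y$ be three splittings each of which is a proper G-weak regular splitting of both types (type I and type II) of $A$, with $\mathcal{R}(K+X-A+YU^{\#}L)=\mathcal{R}(A)$ and $\mathcal{N}(K+X-A+YU^{\#}L)=\mathcal{N}(A)$. Let $\mathcal{H}=X^{\#}YU^{\#}VK^{\#}L$. Then $$\rho(\mathcal{H})\le\min\{\rho(K^{\#}L),\rho(U^{\#}V),\rho(X^{\#}Y)\}<1.$$
   Context: All matrices are real $n\times n$; $\mathcal{R}(\cdot)$, $\mathcal{N}(\cdot)$ denote range and null space; $\rho$ is the spectral radius; $B\ge 0$ means entrywise nonnegative. The group inverse of $A$, when it exists, is the unique matrix $A^{\#}$ with $AA^{\#}A=A$, $A^{\#}AA^{\#}=A^{\#}$, $AA^{\#}=A^{\#}A$; it exists iff $\mathrm{rank}(A)=\mathrm{rank}(A^2)$. $A$ is group monotone if $A^{\#}$ exists and $A^{\#}\ge 0$. An expression $A=U-V$ is a proper splitting of $A$ if $\mathcal{R}(U)=\mathcal{R}(A)$ and $\mathcal{N}(U)=\mathcal{N}(A)$. A proper splitting $A=U-V$ is a proper G-weak regular splitting of type I if $U^{\#}$ exists, $U^{\#}\ge 0$ and $U^{\#}V\ge 0$, and of type II if $U^{\#}$ exists, $U^{\#}\ge 0$ and $VU^{\#}\ge 0$. *)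

theory Defs
  imports
    "Jordan_Normal_Form.Matrix_Kernel"
    "Jordan_Normal_Form.Spectral_Radius"
begin

text \<open>
  Entrywise nonnegativity of a square matrix \<open>B\<close> of size \<open>n\<close> is written \<open>0\<^sub>m n n \<le> B\<close>,
  using the entrywise order on matrices; the null space is \<open>mat_kernel\<close>.
\<close>

definition mat_range :: "'a :: comm_ring_1 mat \<Rightarrow> 'a vec set" where
  "mat_range A = (\<lambda>x. A *\<^sub>v x) ` carrier_vec (dim_col A)"

lemma mat_range_eq_col_space:
  assumes "(A :: 'a :: field mat) \<in> carrier_mat n m"
  shows "mat_range A = vec_space.col_space n A"
  using assms by (auto simp: mat_range_def vec_space.col_space_eq[OF assms])

definition is_group_inverse :: "real mat \<Rightarrow> real mat \<Rightarrow> bool" where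
  "is_group_inverse A G \<longleftrightarrow>
     square_mat A \<and> G \<in> carrier_mat (dim_row A) (dim_row A) \<and>
     A * G * A = A \<and> G * A * G = G \<and> A * G = G * A"

definition group_invertible :: "real mat \<Rightarrow> bool" where
  "group_invertible A \<longleftrightarrow> (\<exists>G. is_group_inverse A G)"

text \<open>Only meaningful for matrices satisfying \<^const>\<open>group_invertible\<close>.\<close>

definition group_inverse :: "real mat \<Rightarrow> real mat" (\<open>_\<^sup>#\<close> [1000] 999) where
  "A\<^sup># = (THE G. is_group_inverse A G)"

lemma is_group_inverse_unique:
  assumes G: "is_group_inverse A G" and H: "is_group_inverse A H"
  shows "G = H"
proof -
  define n where "n = dim_row A"
  have A: "A \<in> carrier_mat n n"
    using G by (auto simp: is_group_inverse_def n_def)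
  have Gc: "G \<in> carrier_mat n n" and Hc: "H \<in> carrier_mat n n"
    using G H by (auto simp: is_group_inverse_def n_def)
  have g: "A * G * A = A" "G * A * G = G" "A * G = G * A"
    using G by (auto simp: is_group_inverse_def)
  have h: "A * H * A = A" "H * A * H = H" "A * H = H * A"
    using H by (auto simp: is_group_inverse_def)
  note as = assoc_mult_mat[of _ n n _ n _ n]
  have "G * A = G * (A * H * A)" by (simp only: h(1))
  also have "\<dots> = (G * A) * (H * A)" using A Gc Hc by (simp add: as)
  also have "\<dots> = (A * G) * (A * H)" by (simp only: g(3) h(3))
  also have "\<dots> = A * G * A * H" using A Gc Hc by (simp add: as)
  also have "\<dots> = A * H" by (simp only: g(1))
  finally have eq: "G * A = A * H" .
  have "G = G * A * G" by (simp only: g(2))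
  also have "\<dots> = A * H * G" by (simp only: eq)
  also have "\<dots> = H * (A * G)" using A Gc Hc by (simp add: as h(3))
  also have "\<dots> = H * (A * H)" by (simp only: g(3) eq)
  also have "\<dots> = H * A * H" using A Gc Hc by (simp add: as)
  finally show ?thesis by (simp only: h(2))
qed

lemma group_inverse_eqI: "is_group_inverse A G \<Longrightarrow> A\<^sup># = G"
  unfolding group_inverse_def by (blast intro: the_equality is_group_inverse_unique)

lemma is_group_inverse_group_inverse: "group_invertible A \<Longrightarrow> is_group_inverse A (A\<^sup>#)"
  unfolding group_invertible_def using group_inverse_eqI by blast

definition group_monotone :: "real mat \<Rightarrow> bool" where
  "group_monotone A \<longleftrightarrow> group_invertible A \<and> 0\<^sub>m (dim_row A) (dim_row A) \<le> A\<^sup>#"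

definition proper_splitting :: "real mat \<Rightarrow> real mat \<Rightarrow> real mat \<Rightarrow> bool" where
  "proper_splitting A U V \<longleftrightarrow>
     U \<in> carrier_mat (dim_row A) (dim_col A) \<and> V \<in> carrier_mat (dim_row A) (dim_col A) \<and>
     A = U - V \<and> mat_range U = mat_range A \<and> mat_kernel U = mat_kernel A"

definition proper_G_weak_regular_I :: "real mat \<Rightarrow> real mat \<Rightarrow> real mat \<Rightarrow> bool" where
  "proper_G_weak_regular_I A U V \<longleftrightarrow>
     proper_splitting A U V \<and> group_invertible U \<and>
     0\<^sub>m (dim_row A) (dim_row A) \<le> U\<^sup># \<and> 0\<^sub>m (dim_row A) (dim_row A) \<le> U\<^sup># * V"

definition proper_G_weak_regular_II :: "real mat \<Rightarrow> real mat \<Rightarrow> real mat \<Rightarrow> bool" where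
  "proper_G_weak_regular_II A U V \<longleftrightarrow>
     proper_splitting A U V \<and> group_invertible U \<and>
     0\<^sub>m (dim_row A) (dim_row A) \<le> U\<^sup># \<and> 0\<^sub>m (dim_row A) (dim_row A) \<le> V * U\<^sup>#"

text \<open>The spectral radius of a real matrix is taken over its complex eigenvalues.\<close>

definition real_spectral_radius :: "real mat \<Rightarrow> real" (\<open>\<rho>\<close>) where
  "\<rho> A = spectral_radius (map_mat complex_of_real A)"

end

theory Submission
  imports Defs
begin

text \<open>
  Put \<open>D = A\<^sup>#\<close>. For a splitting \<open>A = U - V\<close> of both types, \<open>T = U\<^sup># V\<close> satisfies
  \<open>T D = D - U\<^sup># \<le> D\<close>, \<open>T D A = T\<close> and \<open>T D = D T'\<close> with \<open>T' = V U\<^sup># \<ge> 0\<close>.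
  These properties pass to products, and the intertwining with \<open>T'\<close> gives \<open>S T D \<le> S D\<close> as well
  as \<open>S T D \<le> T D\<close>. Hence \<open>H D \<le> T D\<close> for each of the three factors \<open>T\<close> of \<open>H\<close>; the
  intertwining again yields \<open>H\<^sup>k D \<le> T\<^sup>k D\<close> for all \<open>k\<close>, and the spectral radii are compared
  through the growth of powers, without Perron eigenvectors. Finally \<open>T\<^sup>k D\<close> decreases, so
  \<open>T\<^sup>k U\<^sup># = T\<^sup>k D - T\<^sup>k\<^sup>+\<^sup>1 D\<close> tends to zero, and with it \<open>T\<^sup>k = T\<^sup>k U\<^sup># U\<close>.
\<close>

subsection \<open>Entrywise order\<close>

lemma index_mult_mat_sum:
  assumes "A \<in> carrier_mat n m" "B \<in> carrier_mat m p" "i < n" "j < p"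
  shows "(A * B) $$ (i, j) = (\<Sum>l<m. A $$ (i, l) * B $$ (l, j))"
  using assms by (auto simp: scalar_prod_def atLeast0LessThan intro!: sum.cong)

lemma mult_mat_left_mono:
  fixes A B C :: "real mat"
  assumes c: "C \<in> carrier_mat n n" "A \<in> carrier_mat n n" "B \<in> carrier_mat n n"
    and C: "0\<^sub>m n n \<le> C" and AB: "A \<le> B"
  shows "C * A \<le> C * B"
  unfolding less_eq_mat_def
proof (intro conjI allI impI)
  fix i j assume "i < dim_row (C * B)" "j < dim_col (C * B)"
  then have ij: "i < n" "j < n" using c by auto
  show "(C * A) $$ (i, j) \<le> (C * B) $$ (i, j)"
    unfolding index_mult_mat_sum[OF c(1,2) ij] index_mult_mat_sum[OF c(1,3) ij]
    using c C AB ij by (intro sum_mono mult_left_mono) (auto simp: less_eq_mat_def)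
qed (use c in auto)

lemma mult_mat_right_mono:
  fixes A B C :: "real mat"
  assumes c: "C \<in> carrier_mat n n" "A \<in> carrier_mat n n" "B \<in> carrier_mat n n"
    and C: "0\<^sub>m n n \<le> C" and AB: "A \<le> B"
  shows "A * C \<le> B * C"
  unfolding less_eq_mat_def
proof (intro conjI allI impI)
  fix i j assume "i < dim_row (B * C)" "j < dim_col (B * C)"
  then have ij: "i < n" "j < n" using c by auto
  show "(A * C) $$ (i, j) \<le> (B * C) $$ (i, j)"
    unfolding index_mult_mat_sum[OF c(2,1) ij] index_mult_mat_sum[OF c(3,1) ij]
    using c C AB ij by (intro sum_mono mult_right_mono) (auto simp: less_eq_mat_def)
qed (use c in auto)

lemma mult_mat_nonneg:
  fixes A B :: "real mat"
  assumes "A \<in> carrier_mat n n" "B \<in> carrier_mat n n" "0\<^sub>m n n \<le> A" "0\<^sub>m n n \<le> B"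
  shows "0\<^sub>m n n \<le> A * B"
  using mult_mat_left_mono[of A n "0\<^sub>m n n" B] assms by simp

lemma pow_mat_nonneg:
  fixes A :: "real mat"
  assumes "A \<in> carrier_mat n n" "0\<^sub>m n n \<le> A"
  shows "0\<^sub>m n n \<le> A ^\<^sub>m k"
proof (induction k)
  case 0
  show ?case using assms by (auto simp: less_eq_mat_def)
next
  case (Suc k)
  then show ?case using assms by (auto intro: mult_mat_nonneg)
qed

subsection \<open>Spectral radius and growth of powers\<close>

lemma smult_pow_mat:
  assumes "(A :: 'a :: comm_ring_1 mat) \<in> carrier_mat n n"
  shows "(c \<cdot>\<^sub>m A) ^\<^sub>m k = c ^ k \<cdot>\<^sub>m A ^\<^sub>m k"
proof (induction k)
  case 0
  show ?case using assms by (auto simp: one_mat_def)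
next
  case (Suc k)
  have "c ^ k \<cdot>\<^sub>m A ^\<^sub>m k * (c \<cdot>\<^sub>m A) = c \<cdot>\<^sub>m (c ^ k \<cdot>\<^sub>m (A ^\<^sub>m k * A))"
    using assms by (simp add: mult_smult_distrib[of _ n n _ n] mult_smult_assoc_mat[of _ n n _ n])
  also have "\<dots> = c ^ Suc k \<cdot>\<^sub>m (A ^\<^sub>m k * A)"
    by (auto simp: mult.assoc)
  finally show ?case using Suc by simp
qed

lemma eigenvalue_smult_mat:
  assumes "(A :: 'a :: field mat) \<in> carrier_mat n n" "c \<noteq> 0" "eigenvalue (c \<cdot>\<^sub>m A) a"
  shows "eigenvalue A (a / c)"
proof -
  obtain v where v: "v \<in> carrier_vec n" "v \<noteq> 0\<^sub>v n" "(c \<cdot>\<^sub>m A) *\<^sub>v v = a \<cdot>\<^sub>v v"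
    using assms by (auto simp: eigenvalue_def eigenvector_def)
  have "A *\<^sub>v v = (a / c) \<cdot>\<^sub>v v"
  proof (rule eq_vecI)
    fix i assume "i < dim_vec ((a / c) \<cdot>\<^sub>v v)"
    then have i: "i < n" using v by auto
    have "c * (A *\<^sub>v v) $ i = ((c \<cdot>\<^sub>m A) *\<^sub>v v) $ i"
      using i assms(1) v(1) by simp
    also have "\<dots> = a * v $ i" using v i by simp
    finally show "(A *\<^sub>v v) $ i = ((a / c) \<cdot>\<^sub>v v) $ i"
      using i v assms(2) by (simp add: field_simps)
  qed (use assms v in auto)
  then show ?thesis using v assms unfolding eigenvalue_def eigenvector_def by auto
qed

text \<open>Positive \<open>n\<close> makes the complex spectrum nonempty, so the maximum of the
  moduli is attained.\<close>

lemma real_spectral_radius_eigenvalue: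
  assumes "T \<in> carrier_mat n n" "n > 0"
  obtains a where "eigenvalue (map_mat complex_of_real T) a" "norm a = \<rho> T"
  using spectral_radius_mem_max(1)[of "map_mat complex_of_real T" n] assms
  by (auto simp: real_spectral_radius_def spectrum_def)

lemma eigenvalue_le_real_spectral_radius:
  assumes "T \<in> carrier_mat n n" "n > 0" "eigenvalue (map_mat complex_of_real T) a"
  shows "norm a \<le> \<rho> T"
  unfolding real_spectral_radius_def
  by (rule spectral_radius_mem_max(2)[of _ n]) (use assms in \<open>auto simp: spectrum_def\<close>)

lemma real_spectral_radius_nonneg:
  assumes "T \<in> carrier_mat n n" "n > 0"
  shows "0 \<le> \<rho> T"
  by (metis assms norm_ge_zero real_spectral_radius_eigenvalue)

text \<open>Dividing by \<open>s\<close> brings the spectral radius below 1, where the Jordan normal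
  form bounds all powers entrywise by one constant; undoing the scaling restores the factor
  \<open>s ^ k\<close>. At \<open>s = \<rho> T\<close> itself a nontrivial Jordan block could add
  polynomial growth.\<close>

lemma pow_mat_bound_above_spectral_radius:
  fixes T :: "real mat"
  assumes T: "T \<in> carrier_mat n n" and n: "n > 0" and s: "\<rho> T < s"
  obtains c where "\<And>k i j. i < n \<Longrightarrow> j < n \<Longrightarrow> \<bar>(T ^\<^sub>m k) $$ (i, j)\<bar> \<le> c * s ^ k"
proof -
  have s0: "s > 0" using real_spectral_radius_nonneg[OF T n] s by simp
  define M where "M = map_mat complex_of_real T"
  define N where "N = complex_of_real (1 / s) \<cdot>\<^sub>m M"
  have M: "M \<in> carrier_mat n n" and N: "N \<in> carrier_mat n n"
    using T by (auto simp: M_def N_def)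
  have "spectral_radius N < 1"
  proof -
    obtain a where a: "eigenvalue N a" "norm a = spectral_radius N"
      using spectral_radius_mem_max(1)[OF N n] by (auto simp: spectrum_def)
    have "eigenvalue M (a / complex_of_real (1 / s))"
      using eigenvalue_smult_mat[OF M _ a(1)[unfolded N_def]] s0 by simp
    from eigenvalue_le_real_spectral_radius[OF T n this[unfolded M_def]]
    have "norm a * s \<le> \<rho> T" using s0 by (simp add: norm_mult)
    with s have "norm a * s < 1 * s" by simp
    then show ?thesis using s0 a(2) by (metis mult_less_cancel_right_pos)
  qed
  from spectral_radius_jnf_norm_bound_less_1_upper_triangular[OF N this]
  obtain c where c: "norm_bound (N ^\<^sub>m k) c" for k by blast
  show ?thesis
  proof (rule that[of c])
    fix k i j assume ij: "i < n" "j < n"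
    have "M ^\<^sub>m k = map_mat complex_of_real (T ^\<^sub>m k)"
      unfolding M_def by (rule of_real_hom.mat_hom_pow[OF T, symmetric])
    then have "(N ^\<^sub>m k) $$ (i, j) = complex_of_real ((1 / s) ^ k * (T ^\<^sub>m k) $$ (i, j))"
      using ij T unfolding N_def smult_pow_mat[OF M] by simp
    moreover have "norm ((N ^\<^sub>m k) $$ (i, j)) \<le> c"
      using c[of k] ij N by (simp add: norm_bound_def)
    ultimately have "\<bar>(1 / s) ^ k * (T ^\<^sub>m k) $$ (i, j)\<bar> \<le> c"
      by (simp only: norm_of_real)
    then show "\<bar>(T ^\<^sub>m k) $$ (i, j)\<bar> \<le> c * s ^ k"
      using s0 by (simp add: abs_mult field_simps)
  qed
qed

text \<open>This turns strict bounds on the spectral radius into decay of the entries of the powers,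
  so that entrywise inequalities between powers can be used to compare radii.\<close>

lemma real_spectral_radius_less_iff:
  fixes T :: "real mat"
  assumes T: "T \<in> carrier_mat n n" and n: "n > 0" and r: "r > 0"
  shows "\<rho> T < r \<longleftrightarrow> (\<forall>i<n. \<forall>j<n. (\<lambda>k. (T ^\<^sub>m k) $$ (i, j) / r ^ k) \<longlonglongrightarrow> 0)"
proof (intro iffI allI impI)
  fix i j assume "\<rho> T < r" and ij: "i < n" "j < n"
  \<comment> \<open>The gap between \<open>s\<close> and \<open>r\<close> gives geometric decay at
    rate \<open>s / r\<close>.\<close>
  then obtain s where s: "\<rho> T < s" "s < r" using dense by blast
  have s0: "s > 0" using real_spectral_radius_nonneg[OF T n] s by simp
  obtain c where c: "\<And>k i j. i < n \<Longrightarrow> j < n \<Longrightarrow> \<bar>(T ^\<^sub>m k) $$ (i, j)\<bar> \<le> c * s ^ k"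
    using pow_mat_bound_above_spectral_radius[OF T n s(1)] by blast
  have "(\<lambda>k. c * (s / r) ^ k) \<longlonglongrightarrow> c * 0"
    using s s0 by (intro tendsto_mult tendsto_const LIMSEQ_power_zero) auto
  then have lim: "(\<lambda>k. c * (s / r) ^ k) \<longlonglongrightarrow> 0" by simp
  show "(\<lambda>k. (T ^\<^sub>m k) $$ (i, j) / r ^ k) \<longlonglongrightarrow> 0"
  proof (rule tendsto_0_le[OF lim, where K = 1], intro always_eventually allI)
    fix k
    have "norm ((T ^\<^sub>m k) $$ (i, j) / r ^ k) \<le> c * (s / r) ^ k"
      using c[OF ij, of k] r by (simp add: field_simps)
    then show "norm ((T ^\<^sub>m k) $$ (i, j) / r ^ k) \<le> norm (c * (s / r) ^ k) * 1"
      unfolding real_norm_def by linarith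
  qed
next
  assume lim: "\<forall>i<n. \<forall>j<n. (\<lambda>k. (T ^\<^sub>m k) $$ (i, j) / r ^ k) \<longlonglongrightarrow> 0"
  define M where "M = map_mat complex_of_real T"
  have M: "M \<in> carrier_mat n n" using T by (auto simp: M_def)
  obtain a where a: "eigenvalue M a" "norm a = \<rho> T"
    using real_spectral_radius_eigenvalue[OF T n] unfolding M_def by blast
  then obtain v where v: "eigenvector M v a" by (auto simp: eigenvalue_def)
  then have vc: "v \<in> carrier_vec n" and "v \<noteq> 0\<^sub>v n"
    using M by (auto simp: eigenvector_def)
  \<comment> \<open>Reading the powers at a nonzero coordinate of an eigenvector for an eigenvalue
    of maximal modulus isolates \<open>(a / r) ^ k\<close>.\<close>
  then obtain i where i: "i < n" "v $ i \<noteq> 0"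
    by (metis carrier_vecD eq_vecI index_zero_vec)
  have pow: "(a / r) ^ k * v $ i = (\<Sum>j<n. complex_of_real ((T ^\<^sub>m k) $$ (i, j) / r ^ k) * v $ j)" for k
  proof -
    have Mk: "M ^\<^sub>m k = map_mat complex_of_real (T ^\<^sub>m k)"
      unfolding M_def by (rule of_real_hom.mat_hom_pow[OF T, symmetric])
    have "a ^ k * v $ i = (M ^\<^sub>m k *\<^sub>v v) $ i"
      using eigenvector_pow[OF M v] i vc by simp
    also have "\<dots> = (\<Sum>j<n. complex_of_real ((T ^\<^sub>m k) $$ (i, j)) * v $ j)"
      unfolding Mk using i vc T by (auto simp: scalar_prod_def atLeast0LessThan intro!: sum.cong)
    finally show ?thesis by (simp add: power_divide sum_divide_distrib)
  qed
  have "(\<lambda>k. (a / r) ^ k * v $ i) \<longlonglongrightarrow> (\<Sum>j<n. complex_of_real 0 * v $ j)"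
    unfolding pow using lim i by (intro tendsto_sum tendsto_mult tendsto_of_real tendsto_const) auto
  then have "(\<lambda>k. (a / r) ^ k * v $ i / v $ i) \<longlonglongrightarrow> 0 / v $ i"
    using i by (intro tendsto_divide tendsto_const) auto
  then have "(\<lambda>k. (a / r) ^ k) \<longlonglongrightarrow> 0" using i by simp
  \<comment> \<open>One power of norm below 1 suffices, since a base of norm at least 1 has all its
    powers of norm at least 1.\<close>
  from LIMSEQ_D[OF this, of 1] obtain k where "norm ((a / r) ^ k - 0) < 1" by auto
  then have "norm (a / r) ^ k < 1" by (simp only: diff_zero norm_power)
  then have "norm (a / r) < 1" using one_le_power[of "norm (a / r)" k] by linarith
  then show "\<rho> T < r" using a r by (simp add: norm_divide)
qed

subsection \<open>Contractive matrices\<close>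

text \<open>The model is \<open>T = U\<^sup># * V\<close> with \<open>D = A\<^sup>#\<close>. The
  equation \<open>T * D * A = T\<close> recovers \<open>T\<close> from \<open>T * D\<close>. The
  intertwiner \<open>T'\<close> moves the action of \<open>T\<close> to the right of
  \<open>D\<close>, so that inequalities can be multiplied by it from that side as well.\<close>

definition contractive :: "nat \<Rightarrow> real mat \<Rightarrow> real mat \<Rightarrow> real mat \<Rightarrow> bool" where
  "contractive n D A T \<longleftrightarrow> T \<in> carrier_mat n n \<and> 0\<^sub>m n n \<le> T \<and> T * D \<le> D \<and> T * D * A = T \<and>
     (\<exists>T' \<in> carrier_mat n n. 0\<^sub>m n n \<le> T' \<and> T * D = D * T')"

lemma contractive_mult_le_left:
  assumes D: "D \<in> carrier_mat n n" and S: "contractive n D A S" and T: "contractive n D A T"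
  shows "S * T * D \<le> S * D"
proof -
  have c: "S \<in> carrier_mat n n" "0\<^sub>m n n \<le> S" "T \<in> carrier_mat n n" "T * D \<le> D"
    using S T by (auto simp: contractive_def)
  show ?thesis
    unfolding assoc_mult_mat[OF c(1,3) D] by (rule mult_mat_left_mono) (use D c in auto)
qed

text \<open>With the intertwiner of \<open>T\<close>, the product becomes \<open>S * D * T'\<close>,
  and \<open>S * D \<le> D\<close> may be multiplied on the right by the nonnegative
  \<open>T'\<close>. Multiplication from the left alone can only discard the right factor.\<close>

lemma contractive_mult_le_right:
  assumes D: "D \<in> carrier_mat n n" and S: "contractive n D A S" and T: "contractive n D A T"
  shows "S * T * D \<le> T * D"
proof -
  obtain T' where T': "T' \<in> carrier_mat n n" "0\<^sub>m n n \<le> T'" "T * D = D * T'"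
    using T by (auto simp: contractive_def)
  have c: "S \<in> carrier_mat n n" "T \<in> carrier_mat n n" "S * D \<le> D"
    using S T by (auto simp: contractive_def)
  have "S * T * D = S * D * T'"
    using assoc_mult_mat[OF c(1,2) D] assoc_mult_mat[OF c(1) D T'(1)] T'(3) by simp
  also have "\<dots> \<le> T * D"
    unfolding T'(3) by (rule mult_mat_right_mono) (use D c T' in auto)
  finally show ?thesis .
qed

text \<open>The intertwiner of the product is \<open>S' * T'\<close>, in the same order, because
  \<open>S * (D * T') = D * S' * T'\<close>.\<close>

lemma contractive_mult:
  assumes D: "D \<in> carrier_mat n n" and A: "A \<in> carrier_mat n n"
    and S: "contractive n D A S" and T: "contractive n D A T"
  shows "contractive n D A (S * T)"
proof -
  note as = assoc_mult_mat[of _ n n _ n _ n]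
  obtain S' where S': "S' \<in> carrier_mat n n" "0\<^sub>m n n \<le> S'" "S * D = D * S'"
    using S by (auto simp: contractive_def)
  obtain T' where T': "T' \<in> carrier_mat n n" "0\<^sub>m n n \<le> T'" "T * D = D * T'"
    using T by (auto simp: contractive_def)
  have s: "S \<in> carrier_mat n n" "0\<^sub>m n n \<le> S" "S * D \<le> D"
    and t: "T \<in> carrier_mat n n" "0\<^sub>m n n \<le> T" "T * D * A = T"
    using S T by (auto simp: contractive_def)
  have eq: "S * T * D = S * (T * D)" by (rule as) (use D s t in auto)
  have "S * T * D * A = S * (T * D * A)"
    unfolding eq by (rule as) (use D A s t in auto)
  moreover have "S * T * D = D * (S' * T')"
    using eq as[OF s(1) D T'(1)] as[OF D S'(1) T'(1)] S'(3) T'(3) by simp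
  moreover have "S' * T' \<in> carrier_mat n n" "0\<^sub>m n n \<le> S' * T'"
    using S' T' by (auto intro: mult_mat_nonneg)
  ultimately show ?thesis
    unfolding contractive_def t(3)
    using s(1,2) t(1,2) order_trans[OF contractive_mult_le_left[OF D S T] s(3)]
    by (auto intro: mult_mat_nonneg)
qed

section \<open>Comparison of powers and of spectral radii\<close>

lemma pow_mat_mult_right_fixed:
  assumes "(T :: real mat) \<in> carrier_mat n n" "P \<in> carrier_mat n n" "T * P = T" "k > 0"
  shows "T ^\<^sub>m k * P = T ^\<^sub>m k"
proof -
  \<comment> \<open>The last factor \<open>T\<close> absorbs \<open>P\<close>; the zeroth power is
    the identity and has no such factor.\<close>
  obtain m where "k = Suc m" using assms(4) by (cases k) auto
  then show ?thesis using assms assoc_mult_mat[of "T ^\<^sub>m m" n n T n P n] by simp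
qed

text \<open>The matrices \<open>H\<close> and \<open>T\<close> need not commute, so the induction
  step writes the new factor \<open>H\<close> as \<open>H'\<close> on the right of \<open>D\<close>,
  applies the induction hypothesis there, moves it back as \<open>T ^\<^sub>m k * (H * D)\<close>,
  and only then compares \<open>H * D\<close> with \<open>T * D\<close>.\<close>

lemma contractive_pow_mono:
  assumes D: "D \<in> carrier_mat n n"
    and H: "contractive n D A H" and T: "contractive n D A T" and le: "H * D \<le> T * D"
  shows "H ^\<^sub>m k * D \<le> T ^\<^sub>m k * D"
proof (induction k)
  case 0
  show ?case using H T D by (auto simp: contractive_def)
next
  case (Suc k)
  note as = assoc_mult_mat[of _ n n _ n _ n]
  obtain H' where H': "H' \<in> carrier_mat n n" "0\<^sub>m n n \<le> H'" "H * D = D * H'"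
    using H by (auto simp: contractive_def)
  have c: "H \<in> carrier_mat n n" "T \<in> carrier_mat n n" "0\<^sub>m n n \<le> T"
    using H T by (auto simp: contractive_def)
  have "H ^\<^sub>m Suc k * D = H ^\<^sub>m k * D * H'"
    using as[of "H ^\<^sub>m k" H D] as[of "H ^\<^sub>m k" D H'] c D H' by simp
  also have "\<dots> \<le> T ^\<^sub>m k * D * H'"
    by (rule mult_mat_right_mono) (use Suc c D H' in auto)
  also have "\<dots> = T ^\<^sub>m k * (H * D)"
    using as[of "T ^\<^sub>m k" D H'] c D H' by simp
  also have "\<dots> \<le> T ^\<^sub>m k * (T * D)"
    by (rule mult_mat_left_mono) (use c D le in \<open>auto intro: pow_mat_nonneg\<close>)
  also have "\<dots> = T ^\<^sub>m Suc k * D"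
    using as[of "T ^\<^sub>m k" T D] c D by simp
  finally show ?case .
qed

text \<open>Decay relative to \<open>r ^ k\<close> passes from the powers of \<open>T\<close> to
  \<open>T ^\<^sub>m k * D\<close>, by comparison of nonnegative matrices to
  \<open>H ^\<^sub>m k * D\<close>, and after multiplication by \<open>A\<close> to the powers of
  \<open>H\<close>. The last passage is pure linearity, so the signs in \<open>A\<close> do not
  matter.\<close>

lemma contractive_spectral_radius_mono:
  assumes n: "n > 0" and D: "D \<in> carrier_mat n n" "0\<^sub>m n n \<le> D" and A: "A \<in> carrier_mat n n"
    and H: "contractive n D A H" and T: "contractive n D A T" and le: "H * D \<le> T * D"
  shows "\<rho> H \<le> \<rho> T"
\<comment> \<open>Decay characterises strict bounds only, so \<open>\<rho> H\<close> is bounded by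
  every \<open>r\<close> above \<open>\<rho> T\<close>.\<close>
proof (rule dense_ge)
  fix r assume "\<rho> T < r"
  have c: "H \<in> carrier_mat n n" "0\<^sub>m n n \<le> H" "H * D * A = H" "T \<in> carrier_mat n n"
    using H T by (auto simp: contractive_def)
  have r: "r > 0" using real_spectral_radius_nonneg[OF c(4) n] \<open>\<rho> T < r\<close> by simp
  have lim: "(\<lambda>k. (T ^\<^sub>m k) $$ (i, j) / r ^ k) \<longlonglongrightarrow> 0" if "i < n" "j < n" for i j
    using \<open>\<rho> T < r\<close> that unfolding real_spectral_radius_less_iff[OF c(4) n r] by blast
  have limTD: "(\<lambda>k. (T ^\<^sub>m k * D) $$ (i, j) / r ^ k) \<longlonglongrightarrow> 0" if ij: "i < n" "j < n" for i j
  proof -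
    have "(\<lambda>k. \<Sum>l<n. (T ^\<^sub>m k) $$ (i, l) / r ^ k * D $$ (l, j)) \<longlonglongrightarrow> (\<Sum>l<n. 0 * D $$ (l, j))"
      using ij by (intro tendsto_sum tendsto_mult tendsto_const lim) auto
    moreover have "(T ^\<^sub>m k * D) $$ (i, j) / r ^ k = (\<Sum>l<n. (T ^\<^sub>m k) $$ (i, l) / r ^ k * D $$ (l, j))" for k
      using index_mult_mat_sum[OF pow_carrier_mat[OF c(4)] D(1) ij]
      by (simp add: sum_divide_distrib)
    ultimately show ?thesis by simp
  qed
  have limHD: "(\<lambda>k. (H ^\<^sub>m k * D) $$ (i, j) / r ^ k) \<longlonglongrightarrow> 0" if ij: "i < n" "j < n" for i j
  proof (rule tendsto_0_le[OF limTD[OF ij], where K = 1], intro always_eventually allI)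
    fix k
    have "0\<^sub>m n n \<le> H ^\<^sub>m k * D" using c D by (auto intro: mult_mat_nonneg pow_mat_nonneg)
    then have "0 \<le> (H ^\<^sub>m k * D) $$ (i, j)" using ij c D by (auto simp: less_eq_mat_def)
    moreover have "(H ^\<^sub>m k * D) $$ (i, j) \<le> (T ^\<^sub>m k * D) $$ (i, j)"
      using contractive_pow_mono[OF D(1) H T le, of k] ij c D by (auto simp: less_eq_mat_def)
    ultimately show "norm ((H ^\<^sub>m k * D) $$ (i, j) / r ^ k) \<le> norm ((T ^\<^sub>m k * D) $$ (i, j) / r ^ k) * 1"
      using r by (simp add: divide_right_mono)
  qed
  have "(\<lambda>k. (H ^\<^sub>m k) $$ (i, j) / r ^ k) \<longlonglongrightarrow> 0" if ij: "i < n" "j < n" for i j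
  proof -
    have "(\<lambda>k. \<Sum>l<n. (H ^\<^sub>m k * D) $$ (i, l) / r ^ k * A $$ (l, j)) \<longlonglongrightarrow> (\<Sum>l<n. 0 * A $$ (l, j))"
      using ij by (intro tendsto_sum tendsto_mult tendsto_const limHD) auto
    \<comment> \<open>The product \<open>D * A\<close> fixes positive powers of \<open>H\<close>
      from the right; excluding \<open>k = 0\<close> does not affect the limit.\<close>
    moreover have "\<forall>\<^sub>F k in sequentially.
        (\<Sum>l<n. (H ^\<^sub>m k * D) $$ (i, l) / r ^ k * A $$ (l, j)) = (H ^\<^sub>m k) $$ (i, j) / r ^ k"
      using eventually_gt_at_top[of 0]
    proof eventually_elim
      case (elim k)
      have "H * (D * A) = H" using c D A by (metis assoc_mult_mat)
      from pow_mat_mult_right_fixed[OF c(1) _ this elim]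
      have eq: "H ^\<^sub>m k = H ^\<^sub>m k * D * A" using c D A by (simp add: assoc_mult_mat[of _ n n _ n _ n])
      have "(H ^\<^sub>m k) $$ (i, j) = (\<Sum>l<n. (H ^\<^sub>m k * D) $$ (i, l) * A $$ (l, j))"
        using index_mult_mat_sum[OF mult_carrier_mat[OF pow_carrier_mat[OF c(1), of k] D(1)] A ij]
        unfolding eq[symmetric] .
      then show ?case by (simp add: sum_divide_distrib)
    qed
    ultimately show ?thesis using tendsto_cong by fastforce
  qed
  then show "\<rho> H \<le> r"
    using real_spectral_radius_less_iff[OF c(1) n r] by (simp add: less_imp_le)
qed

text \<open>Here \<open>G\<close> stands for \<open>U\<^sup>#\<close>. The entries of
  \<open>T ^\<^sub>m k * D\<close> decrease and are nonnegative, hence converge. Their successive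
  differences, which are the entries of \<open>T ^\<^sub>m k * G\<close>, tend to zero, and
  multiplication by \<open>U\<close> recovers the powers of \<open>T\<close>.\<close>

lemma contractive_spectral_radius_less_1:
  assumes n: "n > 0" and D: "D \<in> carrier_mat n n" "0\<^sub>m n n \<le> D"
    and T: "contractive n D A T"
    and G: "G \<in> carrier_mat n n" "T * D = D - G"
    and U: "U \<in> carrier_mat n n" "T * (G * U) = T"
  shows "\<rho> T < 1"
proof -
  have c: "T \<in> carrier_mat n n" "0\<^sub>m n n \<le> T" "T * D \<le> D"
    using T by (auto simp: contractive_def)
  note as = assoc_mult_mat[of _ n n _ n _ n]
  have limG: "(\<lambda>k. (T ^\<^sub>m k * G) $$ (i, j)) \<longlonglongrightarrow> 0" if ij: "i < n" "j < n" for i j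
  proof -
    let ?f = "\<lambda>k. (T ^\<^sub>m k * D) $$ (i, j)"
    have "G = D - T * D" using G c D by (intro eq_matI) auto
    then have "T ^\<^sub>m k * G = T ^\<^sub>m k * D - T ^\<^sub>m Suc k * D" for k
      using c D mult_minus_distrib_mat[of "T ^\<^sub>m k" n n D n "T * D"] as[of "T ^\<^sub>m k" T D] by simp
    then have diff: "(T ^\<^sub>m k * G) $$ (i, j) = ?f k - ?f (Suc k)" for k
      using ij c D by simp
    have "0 \<le> ?f k" for k
      using mult_mat_nonneg[OF _ D(1) pow_mat_nonneg[OF c(1,2)] D(2), of k] ij c D
      by (auto simp: less_eq_mat_def)
    moreover have "decseq ?f"
    proof (rule decseq_SucI)
      fix k
      have "T ^\<^sub>m k * (T * D) \<le> T ^\<^sub>m k * D"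
        by (rule mult_mat_left_mono) (use c D in \<open>auto intro: pow_mat_nonneg\<close>)
      then show "?f (Suc k) \<le> ?f k"
        using ij c D as[of "T ^\<^sub>m k" T D] by (auto simp: less_eq_mat_def simp del: index_mult_mat(1))
    qed
    ultimately obtain L where "?f \<longlonglongrightarrow> L" using decseq_convergent by metis
    then have "(\<lambda>k. ?f k - ?f (Suc k)) \<longlonglongrightarrow> L - L" by (intro tendsto_diff LIMSEQ_Suc)
    then show ?thesis unfolding diff by simp
  qed
  have "(\<lambda>k. (T ^\<^sub>m k) $$ (i, j)) \<longlonglongrightarrow> 0" if ij: "i < n" "j < n" for i j
  proof -
    have "(\<lambda>k. \<Sum>l<n. (T ^\<^sub>m k * G) $$ (i, l) * U $$ (l, j)) \<longlonglongrightarrow> (\<Sum>l<n. 0 * U $$ (l, j))"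
      using ij by (intro tendsto_sum tendsto_mult tendsto_const limG) auto
    moreover have "\<forall>\<^sub>F k in sequentially.
        (\<Sum>l<n. (T ^\<^sub>m k * G) $$ (i, l) * U $$ (l, j)) = (T ^\<^sub>m k) $$ (i, j)"
      using eventually_gt_at_top[of 0]
    proof eventually_elim
      case (elim k)
      from pow_mat_mult_right_fixed[OF c(1) _ U(2) elim]
      have eq: "T ^\<^sub>m k = T ^\<^sub>m k * G * U" using c G(1) U(1) by (simp add: as)
      show ?case
        using index_mult_mat_sum[OF mult_carrier_mat[OF pow_carrier_mat[OF c(1), of k] G(1)] U(1) ij, symmetric]
        unfolding eq[symmetric] .
    qed
    ultimately show ?thesis using tendsto_cong by fastforce
  qed
  then show ?thesis using real_spectral_radius_less_iff[OF c(1) n, of 1] by simp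
qed

subsection \<open>Proper splittings\<close>

lemma mult_unit_vec_eq_col:
  assumes "(A :: 'a :: semiring_1 mat) \<in> carrier_mat n m" "j < m"
  shows "A *\<^sub>v unit_vec m j = col A j"
  using assms by (intro eq_vecI) auto

text \<open>Each column of \<open>B\<close> has the form \<open>C *\<^sub>v y\<close>, and
  \<open>P\<close> acts as the identity on such vectors.\<close>

lemma mult_left_fixed_of_range_subset:
  assumes c: "(P :: real mat) \<in> carrier_mat n n" "B \<in> carrier_mat n n" "C \<in> carrier_mat n n"
    and sub: "mat_range B \<subseteq> mat_range C" and PC: "P * C = C"
  shows "P * B = B"
proof (rule mat_col_eqI)
  fix j assume "j < dim_col B"
  then have j: "j < n" using c by simp
  have "col B j = B *\<^sub>v unit_vec n j" using mult_unit_vec_eq_col[OF c(2) j] by simp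
  then have "col B j \<in> mat_range B" using c by (auto simp: mat_range_def)
  then obtain y where y: "y \<in> carrier_vec n" "col B j = C *\<^sub>v y"
    using sub c by (auto simp: mat_range_def)
  have "col (P * B) j = P *\<^sub>v (C *\<^sub>v y)" using col_mult2[OF c(1,2) j] y by simp
  also have "\<dots> = (P * C) *\<^sub>v y" using c y by simp
  finally show "col (P * B) j = col B j" unfolding PC y(2) .
qed (use c in auto)

lemma mult_right_fixed_of_kernel_subset:
  assumes c: "(P :: real mat) \<in> carrier_mat n n" "B \<in> carrier_mat n n" "C \<in> carrier_mat n n"
    and sub: "mat_kernel C \<subseteq> mat_kernel B" and CP: "C * P = C"
  shows "B * P = B"
proof (rule mat_col_eqI)
  fix j assume "j < dim_col B"
  then have j: "j < n" using c by simp
  \<comment> \<open>For every \<open>Q\<close>, the vector \<open>Q *\<^sub>v x\<close> is column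
    \<open>j\<close> of \<open>Q - Q * P\<close>. Thus \<open>C * P = C\<close> puts
    \<open>x\<close> into the kernel of \<open>C\<close>, hence into that of
    \<open>B\<close>.\<close>
  define x where "x = unit_vec n j - col P j"
  have P: "col P j \<in> carrier_vec n" using c by (auto simp: col_def)
  then have x: "x \<in> carrier_vec n" by (auto simp: x_def)
  have mult: "Q *\<^sub>v x = col Q j - col (Q * P) j" if "Q \<in> carrier_mat n n" for Q
    unfolding x_def using that P j mult_unit_vec_eq_col[OF that j] col_mult2[OF that c(1) j]
      mult_minus_distrib_mat_vec[OF that, of "unit_vec n j" "col P j"] by simp
  have "C *\<^sub>v x = 0\<^sub>v n" unfolding mult[OF c(3)] CP using c by auto
  then have "x \<in> mat_kernel B" using sub c x by (auto simp: mat_kernel_def)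
  then have "B *\<^sub>v x = 0\<^sub>v n" using c by (auto simp: mat_kernel_def)
  then have 0: "col B j - col (B * P) j = 0\<^sub>v n" unfolding mult[OF c(2)] .
  show "col (B * P) j = col B j"
  proof (rule eq_vecI)
    fix i assume "i < dim_vec (col B j)"
    then have "i < n" using c by simp
    moreover from this have "(col B j - col (B * P) j) $ i = 0" unfolding 0 by simp
    ultimately show "col (B * P) j $ i = col B j $ i" using c j by simp
  qed (use c in auto)
qed (use c in auto)

text \<open>Both sides are the projection onto the range of \<open>A\<close> along its null space;
  the range equality and the kernel equality of the splitting are each used once.\<close>

lemma proper_splitting_same_projection:
  assumes A: "A \<in> carrier_mat n n" "group_invertible A"
    and U: "proper_splitting A U V" "group_invertible U"
  shows "U * U\<^sup># = A\<^sup># * A"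
proof -
  note as = assoc_mult_mat[of _ n n _ n _ n]
  have c: "U \<in> carrier_mat n n" using A U by (auto simp: proper_splitting_def)
  have a: "A\<^sup># \<in> carrier_mat n n" "A * A\<^sup># * A = A" "A * A\<^sup># = A\<^sup># * A"
    using is_group_inverse_group_inverse[OF A(2)] A by (auto simp: is_group_inverse_def)
  have u: "U\<^sup># \<in> carrier_mat n n" "U * U\<^sup># * U = U" "U * U\<^sup># = U\<^sup># * U"
    using is_group_inverse_group_inverse[OF U(2)] c by (auto simp: is_group_inverse_def)
  have "A\<^sup># * A * U = U"
    by (rule mult_left_fixed_of_range_subset[of _ n _ A])
      (use A a c U in \<open>auto simp: proper_splitting_def\<close>)
  then have "U * U\<^sup># = A\<^sup># * A * U * U\<^sup>#" by simp
  also have "\<dots> = A\<^sup># * (A * (U * U\<^sup>#))" using A(1) a(1) c u(1) by (simp add: as)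
  \<comment> \<open>Commutation gives \<open>U * (U * U\<^sup>#) = U * U\<^sup># * U = U\<close>,
    and the equality of kernels carries this from \<open>U\<close> to \<open>A\<close>.\<close>
  also have "A * (U * U\<^sup>#) = A"
    by (rule mult_right_fixed_of_kernel_subset[of _ n _ U])
      (use A(1) c u(1) U(1) as[of U U "U\<^sup>#"] as[of U "U\<^sup>#" U] u(2,3) in \<open>auto simp: proper_splitting_def\<close>)
  finally show ?thesis .
qed

text \<open>All four follow from \<open>V = U - A\<close> and the common projection. The first two
  have the same right-hand side and together give the intertwining of \<open>U\<^sup># * V\<close>
  with \<open>V * U\<^sup>#\<close> through \<open>A\<^sup>#\<close>; the last two say that the
  projection fixes \<open>U\<^sup># * V\<close> from the right.\<close>

lemma proper_splitting_identities:
  assumes A: "A \<in> carrier_mat n n" "group_invertible A"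
    and U: "proper_splitting A U V" "group_invertible U"
  shows "U\<^sup># * V * A\<^sup># = A\<^sup># - U\<^sup># \<and> A\<^sup># * (V * U\<^sup>#) = A\<^sup># - U\<^sup># \<and>
    U\<^sup># * V * A\<^sup># * A = U\<^sup># * V \<and> U\<^sup># * V * (U\<^sup># * U) = U\<^sup># * V"
proof -
  define D where "D = A\<^sup>#"
  define G where "G = U\<^sup>#"
  note as = assoc_mult_mat[of _ n n _ n _ n]
  note A' = A(1)
  have U': "U \<in> carrier_mat n n" and V': "V \<in> carrier_mat n n" and AUV: "A = U - V"
    using A' U by (auto simp: proper_splitting_def)
  have V_eq: "V = U - A" unfolding AUV using U' V' by (intro eq_matI) auto
  have a: "D \<in> carrier_mat n n" "D * A * D = D" "A * D = D * A"
    using is_group_inverse_group_inverse[OF A(2)] A' by (auto simp: is_group_inverse_def D_def)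
  have u: "G \<in> carrier_mat n n" "G * U * G = G" "U * G = G * U"
    using is_group_inverse_group_inverse[OF U(2)] U' by (auto simp: is_group_inverse_def G_def)
  have P: "U * G = D * A" "G * U = D * A"
    using proper_splitting_same_projection[OF A U] u(3) by (auto simp: D_def G_def)
  \<comment> \<open>The projection \<open>D * A\<close> equals \<open>U * G\<close> and
    \<open>G * U\<close>, so both products reduce to \<open>G * U * G\<close>.\<close>
  have GAD: "G * A * D = G" and DAG: "D * A * G = G"
    using as[OF u(1) A' a(1)] as[OF u(1) U' u(1)] a(3) P u(2) by simp_all
  have GV: "G * V = D * A - G * A"
    unfolding V_eq mult_minus_distrib_mat[OF u(1) U' A'] P ..
  have VG: "V * G = D * A - A * G"
    unfolding V_eq minus_mult_distrib_mat[OF U' A' u(1)] P ..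
  have TD: "G * V * D = D - G"
    unfolding GV using minus_mult_distrib_mat[of "D * A" n n "G * A" D n] A' a u GAD by simp
  have "D * (V * G) = D * (D * A) - D * (A * G)"
    unfolding VG using mult_minus_distrib_mat[of D n n "D * A" n "A * G"] A' a u by simp
  also have "D * (D * A) = D" using as[OF a(1) A' a(1)] a(2,3) by simp
  also have "D * (A * G) = G" using as[OF a(1) A' u(1)] DAG by simp
  finally have DT: "D * (V * G) = D - G" .
  have TDA: "G * V * D * A = G * V"
    unfolding TD unfolding GV using minus_mult_distrib_mat[OF a(1) u(1) A'] by simp
  then have "G * V * (G * U) = G * V"
    unfolding P using as[of "G * V" D A] V' A' a u by simp
  with TD DT TDA show ?thesis by (simp add: D_def G_def)
qed

text \<open>Type I gives nonnegativity of \<open>U\<^sup># * V\<close>, type II that of its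
  intertwiner \<open>V * U\<^sup>#\<close>; the bound by \<open>A\<^sup>#\<close> comes from
  \<open>U\<^sup># * V * A\<^sup># = A\<^sup># - U\<^sup>#\<close> with \<open>U\<^sup>#\<close>
  nonnegative.\<close>

lemma proper_G_weak_regular_contractive:
  assumes A: "A \<in> carrier_mat n n" "group_invertible A"
    and I: "proper_G_weak_regular_I A U V" and II: "proper_G_weak_regular_II A U V"
  shows "contractive n (A\<^sup>#) A (U\<^sup># * V)"
proof -
  have s: "proper_splitting A U V" "group_invertible U"
    using I by (auto simp: proper_G_weak_regular_I_def)
  have c: "U \<in> carrier_mat n n" "V \<in> carrier_mat n n"
    using A s by (auto simp: proper_splitting_def)
  have inv: "A\<^sup># \<in> carrier_mat n n" "U\<^sup># \<in> carrier_mat n n"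
    using is_group_inverse_group_inverse[OF A(2)] is_group_inverse_group_inverse[OF s(2)] A c
    by (auto simp: is_group_inverse_def)
  have nn: "0\<^sub>m n n \<le> U\<^sup>#" "0\<^sub>m n n \<le> U\<^sup># * V" "0\<^sub>m n n \<le> V * U\<^sup>#"
    using I II A by (auto simp: proper_G_weak_regular_I_def proper_G_weak_regular_II_def)
  have "A\<^sup># - U\<^sup># \<le> A\<^sup>#" using nn(1) inv by (auto simp: less_eq_mat_def)
  then show ?thesis
    unfolding contractive_def using nn c inv proper_splitting_identities[OF A s]
    by (intro conjI bexI[of _ "V * U\<^sup>#"]) auto
qed

theorem theorem3p17:
  fixes n :: nat and A K L U V X Y H :: "real mat"
  assumes n: "n > 0"
    and A: "A \<in> carrier_mat n n"
    and mono: "group_monotone A"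
    and KL: "proper_G_weak_regular_I A K L" "proper_G_weak_regular_II A K L"
    and UV: "proper_G_weak_regular_I A U V" "proper_G_weak_regular_II A U V"
    and XY: "proper_G_weak_regular_I A X Y" "proper_G_weak_regular_II A X Y"
    and rng: "mat_range (K + X - A + Y * U\<^sup># * L) = mat_range A"
    and ker: "mat_kernel (K + X - A + Y * U\<^sup># * L) = mat_kernel A"
    and H: "H = X\<^sup># * Y * U\<^sup># * V * K\<^sup># * L"
  shows "\<rho> H \<le> Min {\<rho> (K\<^sup># * L), \<rho> (U\<^sup># * V), \<rho> (X\<^sup># * Y)} \<and>
         Min {\<rho> (K\<^sup># * L), \<rho> (U\<^sup># * V), \<rho> (X\<^sup># * Y)} < 1"
proof -
  have inv: "W\<^sup># \<in> carrier_mat n n"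
    if "group_invertible W" "W \<in> carrier_mat n n" for W
    using is_group_inverse_group_inverse[OF that(1)] that(2) by (auto simp: is_group_inverse_def)
  have carr: "W \<in> carrier_mat n n" "Z \<in> carrier_mat n n" "W\<^sup># \<in> carrier_mat n n"
    if "proper_G_weak_regular_I A W Z" for W Z
    using that A inv[of W] by (auto simp: proper_G_weak_regular_I_def proper_splitting_def)
  have ai: "group_invertible A" and D: "A\<^sup># \<in> carrier_mat n n" "0\<^sub>m n n \<le> A\<^sup>#"
    using mono A inv[OF _ A] by (auto simp: group_monotone_def)
  define R S T where "R = X\<^sup># * Y" and "S = U\<^sup># * V" and "T = K\<^sup># * L"
  note defs = R_def S_def T_def
  have R: "contractive n (A\<^sup>#) A R" and S: "contractive n (A\<^sup>#) A S" and T: "contractive n (A\<^sup>#) A T"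
    unfolding defs using A ai KL UV XY by (auto intro: proper_G_weak_regular_contractive)
  have H': "H = R * S * T"
    unfolding H defs
    using carr[OF KL(1)] carr[OF UV(1)] carr[OF XY(1)]
    by (simp add: assoc_mult_mat[of _ n n _ n _ n])
  note RS = contractive_mult[OF D(1) A R S]
  note HC = contractive_mult[OF D(1) A RS T, folded H']
  note HRS = contractive_mult_le_left[OF D(1) RS T, folded H']
  \<comment> \<open>Discarding \<open>T\<close> on the right leaves \<open>R * S\<close>, from which
    either factor can be discarded; discarding \<open>R * S\<close> on the left leaves
    \<open>T\<close>.\<close>
  have "H * A\<^sup># \<le> R * A\<^sup>#" "H * A\<^sup># \<le> S * A\<^sup>#" "H * A\<^sup># \<le> T * A\<^sup>#"
    using order_trans[OF HRS contractive_mult_le_left[OF D(1) R S]]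
      order_trans[OF HRS contractive_mult_le_right[OF D(1) R S]]
      contractive_mult_le_right[OF D(1) RS T, folded H'] by auto
  then have "\<rho> H \<le> \<rho> R" "\<rho> H \<le> \<rho> S" "\<rho> H \<le> \<rho> T"
    using contractive_spectral_radius_mono[OF n D A HC] R S T by auto
  \<comment> \<open>The minimum is at most \<open>\<rho> T\<close>, so a bound for this one factor
    settles the strict inequality.\<close>
  moreover have "\<rho> T < 1"
  proof -
    have "proper_splitting A K L" "group_invertible K"
      using KL by (auto simp: proper_G_weak_regular_I_def)
    from proper_splitting_identities[OF A ai this] show ?thesis
      using contractive_spectral_radius_less_1[OF n D T, of "K\<^sup>#" K] carr[OF KL(1)]
      unfolding defs by auto
  qed
  ultimately show ?thesis unfolding defs by (auto simp: min_less_iff_disj)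
qed

end
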